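(* There are absolute constants $c,C>0$ such that for every finite set $A$ of positive real numbers and every $K\geq 1$ with $|AA| \leq K|A|$, \[ |(A+1)(A+1)(A+1)| \gg \frac{|A|^{2+c}}{K^C}, \] where the implied constant is absolute.
   Context: $AA=\{ab:a,b\in A\}$, $A+1=\{a+1:a\in A\}$, and $(A+1)(A+1)(A+1)=\{xyz:x,y,z\in A+1\}$. *)

theory Defs
  imports Complex_Main
begin

definition prodset :: "real set \<Rightarrow> real set \<Rightarrow> real set" where
  "prodset A B = {a * b | a b. a \<in> A \<and> b \<in> B}"

definition shift1 :: "real set \<Rightarrow> real set" where
  "shift1 A = {a + 1 | a. a \<in> A}"

definition triple_prod :: "real set \<Rightarrow> real set" where
  "triple_prod B = {x * y * z | x y z. x \<in> B \<and> y \<in> B \<and> z \<in> B}"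

end

theory Submission
  imports Defs "HOL-Analysis.Convex"
begin

text \<open>
  Write \<open>B = A + 1\<close>, \<open>N = |A|\<close>; constants and powers of \<open>K\<close> are suppressed. All estimates come from squeezing:
  a strictly increasing chain inside a finite set \<open>V\<close> has on average small gaps, measured by the number
  of elements of \<open>V\<close> between neighbours, and \<open>V\<close> has few pairs with a small gap.

  First, \<open>|BB| \<ge> N\<^sup>2 / (1 + ln N)\<close>. If \<open>x \<noteq> 1\<close> has \<open>\<tau>\<close> representations \<open>x = (a + 1) / (b + 1)\<close>, then for all
  \<open>h, h' \<in> A\<close> the line \<open>v = (x h' / h) u + (x - 1) h'\<close> contains the \<open>\<tau>\<close> points \<open>(b h, a h')\<close> of \<open>AA \<times> AA\<close>.
  A line \<open>v = m u + c\<close> arises at most as often as \<open>v = m u - c\<close> meets \<open>A \<times> A\<close>, since \<open>h' = m h - c\<close>.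
  The Szemeredi-Trotter bound for grids, applied to both families, leaves at most \<open>N\<^sup>2 / \<tau>\<^sup>2\<close> such \<open>x\<close>,
  so that \<open>B\<close> has multiplicative energy at most \<open>N\<^sup>2 (1 + ln N)\<close>.

  Secondly, \<open>|BY| \<ge> (N |Y|) powr (3/4)\<close> for every finite set \<open>Y\<close> of positive numbers; \<open>Y = BB\<close> then
  gives the theorem. Let \<open>d\<close> be a popular ratio of consecutive elements of \<open>A\<close>, and \<open>\<delta>(a) = (d a + 1) / (a + 1)\<close>.
  Whenever \<open>t = (a + 1) y\<close>, the element \<open>t \<delta>(a) = (d a + 1) y\<close> of \<open>BY\<close> lies close to \<open>t\<close>. For neighbours \<open>a < a'\<close> among
  the \<open>a\<close> belonging to the same \<open>t\<close>, the pair \<open>(t \<delta>(a), t \<delta>(a'))\<close> is much closer still, and together with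
  \<open>a' / a\<close> it determines \<open>a\<close> up to two choices, because \<open>\<delta>(e a) = x \<delta>(a)\<close> is a quadratic equation in \<open>a\<close>.
\<close>

section \<open>Gaps between consecutive elements\<close>

definition consec :: "real set \<Rightarrow> (real \<times> real) set" where
  "consec S = {(a, b). a \<in> S \<and> b \<in> S \<and> a < b \<and> (\<forall>s\<in>S. \<not> (a < s \<and> s < b))}"

text \<open>With the left end excluded and the right end included, gaps along a chain count disjoint
  parts of \<open>V\<close>, and an increasing pair with right end in \<open>V\<close> has gap at
  least 1.\<close>

definition gap :: "real set \<Rightarrow> real \<times> real \<Rightarrow> nat" where
  "gap V p = card (V \<inter> {fst p<..snd p})"

lemma consec_subset: "consec S \<subseteq> S \<times> S"
  by (auto simp: consec_def)

lemma finite_consec [simp]: "finite S \<Longrightarrow> finite (consec S)"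
  by (rule finite_subset[OF consec_subset]) simp

text \<open>Every element except the maximum has a successor \<open>nx a\<close>; the
  \<open>+ 1\<close> pays for the maximum.\<close>

lemma card_le_card_consec:
  assumes "finite S"
  shows "card S \<le> card (consec S) + 1"
proof (cases "S = {}")
  case False
  define nx where "nx a = Min {s \<in> S. a < s}" for a
  have mem: "(a, nx a) \<in> consec S" if "a \<in> S - {Max S}" for a
  proof -
    have fin: "finite {s \<in> S. a < s}" using assms by simp
    have "a < Max S" using that assms by (auto simp: order_less_le)
    then have ne: "{s \<in> S. a < s} \<noteq> {}" using assms False Max_in by blast
    have "nx a \<in> {s \<in> S. a < s}" unfolding nx_def by (rule Min_in[OF fin ne])
    moreover have "nx a \<le> s" if "s \<in> S" "a < s" for s
      unfolding nx_def using that fin by (intro Min_le) auto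
    ultimately show ?thesis using that by (force simp: consec_def)
  qed
  have "card (S - {Max S}) \<le> card (consec S)"
    by (rule card_inj_on_le[where f = "\<lambda>a. (a, nx a)"]) (use mem assms in \<open>auto simp: inj_on_def\<close>)
  moreover have "card (S - {Max S}) = card S - 1"
    using assms False by (intro card_Diff_singleton) auto
  ultimately show ?thesis by linarith
qed simp

text \<open>Monotonicity keeps the image intervals of different consecutive pairs disjoint.
  \<open>W\<close> is kept apart from \<open>V\<close> so that a chain confined to a short window is
  charged only for that window.\<close>

lemma sum_gap_consec:
  assumes "finite S" "finite W"
    and mono: "\<And>a b. a \<in> S \<Longrightarrow> b \<in> S \<Longrightarrow> a \<le> b \<Longrightarrow> \<phi> a \<le> (\<phi> b :: real)"
    and sub: "\<And>a b. (a, b) \<in> consec S \<Longrightarrow> V \<inter> {\<phi> a<..\<phi> b} \<subseteq> W"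
  shows "(\<Sum>(a, b)\<in>consec S. gap V (\<phi> a, \<phi> b)) \<le> card W"
proof -
  have disj: "{\<phi> a<..\<phi> b} \<inter> {\<phi> a'<..\<phi> b'} = {}"
    if "(a, b) \<in> consec S" "(a', b') \<in> consec S" "a < a'" for a b a' b'
  proof -
    have "b \<le> a'" using that by (force simp: consec_def)
    then have "\<phi> b \<le> \<phi> a'" using that by (intro mono) (auto simp: consec_def)
    then show ?thesis by auto
  qed
  have eq: "b = b'" if "(a, b) \<in> consec S" "(a, b') \<in> consec S" for a b b'
    using that by (force simp: consec_def)
  let ?A = "\<lambda>p. V \<inter> {\<phi> (fst p)<..\<phi> (snd p)}"
  have sub': "?A p \<subseteq> W" if "p \<in> consec S" for p
    using sub[of "fst p" "snd p"] that by simp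
  have "card (\<Union>p\<in>consec S. ?A p) = (\<Sum>p\<in>consec S. card (?A p))"
  proof (rule card_UN_disjoint)
    show "\<forall>p\<in>consec S. finite (?A p)"
      using sub' assms(2) by (blast intro: finite_subset)
    show "\<forall>p\<in>consec S. \<forall>q\<in>consec S. p \<noteq> q \<longrightarrow> ?A p \<inter> ?A q = {}"
    proof (intro ballI impI)
      fix p q assume pq: "p \<in> consec S" "q \<in> consec S" "p \<noteq> q"
      then have "fst p \<noteq> fst q" using eq by (metis prod.collapse)
      then consider "fst p < fst q" | "fst q < fst p" by linarith
      then show "?A p \<inter> ?A q = {}"
        using disj[of "fst p" "snd p" "fst q" "snd q"] disj[of "fst q" "snd q" "fst p" "snd p"] pq
        by cases auto
    qed
  qed (use assms(1) in simp)
  moreover have "card (\<Union>p\<in>consec S. ?A p) \<le> card W"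
    using sub' by (intro card_mono UN_least assms(2))
  ultimately show ?thesis by (simp add: gap_def case_prod_unfold)
qed

text \<open>For fixed \<open>u\<close>, the gap up to the farthest admissible \<open>v\<close>
  contains all admissible ones, so there are at most \<open>g\<close> of them.\<close>

lemma card_close_pairs:
  assumes "finite V" "0 \<le> g"
  shows "real (card {p \<in> V \<times> V. fst p < snd p \<and> real (gap V p) \<le> g}) \<le> real (card V) * g"
proof -
  let ?R = "\<lambda>u. {v \<in> V. u < v \<and> real (gap V (u, v)) \<le> g}"
  have R: "real (card (?R u)) \<le> g" for u
  proof (cases "?R u = {}")
    case False
    have fin: "finite (?R u)" using assms by simp
    have m: "Max (?R u) \<in> ?R u" by (rule Max_in[OF fin False])
    have "?R u \<subseteq> V \<inter> {u<..Max (?R u)}" using Max_ge[OF fin] by auto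
    then have "card (?R u) \<le> gap V (u, Max (?R u))"
      unfolding gap_def using assms(1) by (auto intro!: card_mono)
    then show ?thesis using m by (auto intro: order_trans[rotated])
  next
    case True
    then show ?thesis using assms by (simp only: card.empty)
  qed
  have "{p \<in> V \<times> V. fst p < snd p \<and> real (gap V p) \<le> g} = Sigma V ?R" by auto
  then have "real (card {p \<in> V \<times> V. fst p < snd p \<and> real (gap V p) \<le> g}) = (\<Sum>u\<in>V. real (card (?R u)))"
    using assms by (simp add: card_SigmaI)
  also have "\<dots> \<le> (\<Sum>u\<in>V. g)" by (intro sum_mono R)
  finally show ?thesis by simp
qed

section \<open>Squeezing inequalities with one and with two gap functions\<close>

lemma markov_count:
  fixes w :: "'i \<Rightarrow> real"
  assumes "finite I" "\<And>i. i \<in> I \<Longrightarrow> 0 \<le> w i" "(\<Sum>i\<in>I. w i) \<le> s"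
  shows "g * real (card {i \<in> I. g < w i}) \<le> s"
proof -
  have "g * real (card {i \<in> I. g < w i}) = (\<Sum>i\<in>{i \<in> I. g < w i}. g)" by simp
  also have "\<dots> \<le> (\<Sum>i\<in>{i \<in> I. g < w i}. w i)" by (intro sum_mono) auto
  also have "\<dots> \<le> (\<Sum>i\<in>I. w i)" by (intro sum_mono2) (use assms in auto)
  finally show ?thesis using assms(3) by linarith
qed

lemma card_le_fibres:
  assumes "finite I" "finite T" "f ` I \<subseteq> T" "0 \<le> k"
    and "\<And>i. i \<in> I \<Longrightarrow> real (card {j \<in> I. f j = f i}) \<le> k"
  shows "real (card I) \<le> k * real (card T)"
proof -
  have "real (card I) = (\<Sum>t\<in>T. \<Sum>j\<in>{j \<in> I. f j = t}. 1)"
    using sum.group[of I T f "\<lambda>_. 1 :: real"] assms by simp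
  also have "\<dots> \<le> (\<Sum>t\<in>T. k)"
  proof (rule sum_mono)
    fix t
    show "(\<Sum>j\<in>{j \<in> I. f j = t}. 1) \<le> k"
    proof (cases "{j \<in> I. f j = t} = {}")
      case False
      then show ?thesis using assms(5) by auto
    qed (simp only: sum.empty assms(4))
  qed
  finally show ?thesis by (simp add: mult.commute)
qed

text \<open>Each gap counts its own right end, so it is at least 1. For nonempty \<open>I\<close>
  this makes \<open>s\<close> positive, and the thresholds in the next two proofs can be divided
  out.\<close>

lemma card_le_sum_gap:
  assumes "finite U" "\<And>i. i \<in> I \<Longrightarrow> f i \<in> U \<times> U \<and> fst (f i) < snd (f i)"
    and "(\<Sum>i\<in>I. real (gap U (f i))) \<le> s"
  shows "real (card I) \<le> s"
proof -
  have "1 \<le> gap U (f i)" if "i \<in> I" for i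
  proof -
    have "snd (f i) \<in> U \<inter> {fst (f i)<..snd (f i)}"
      using assms(2)[OF that] by auto
    then show ?thesis using assms(1) by (auto simp: gap_def Suc_le_eq card_gt_0_iff)
  qed
  then have "(\<Sum>i\<in>I. (1::real)) \<le> (\<Sum>i\<in>I. real (gap U (f i)))"
    by (intro sum_mono) force
  then show ?thesis using assms(3) by simp
qed

text \<open>With \<open>T\<close> elements in \<open>I\<close>, at least half have a gap at most
  twice the average, \<open>2 * s / T\<close>. They land in at most
  \<open>card U * (2 * s / T)\<close> close pairs, each hit at most \<open>k\<close> times.\<close>

lemma one_gap_count:
  fixes f :: "'i \<Rightarrow> real \<times> real"
  assumes "finite I" "finite U"
    and f: "\<And>i. i \<in> I \<Longrightarrow> f i \<in> U \<times> U \<and> fst (f i) < snd (f i)"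
    and s: "(\<Sum>i\<in>I. real (gap U (f i))) \<le> s"
    and k: "\<And>i. i \<in> I \<Longrightarrow> real (card {j \<in> I. f j = f i}) \<le> k" "0 \<le> k"
  shows "real (card I) ^ 2 \<le> 4 * k * real (card U) * s"
proof (cases "I = {}")
  case True
  then show ?thesis using s k by simp
next
  case False
  define T where "T = real (card I)"
  have T: "T > 0" using False assms(1) by (simp add: T_def card_gt_0_iff)
  have s0: "T \<le> s" using card_le_sum_gap[OF assms(2) f s] by (simp add: T_def)
  define g where "g = 2 * s / T"
  define J where "J = {i \<in> I. real (gap U (f i)) \<le> g}"
  have bad: "g * real (card {i \<in> I. g < real (gap U (f i))}) \<le> s"
    using markov_count[OF assms(1) _ s] by simp
  then have bad': "real (card {i \<in> I. g < real (gap U (f i))}) \<le> T / 2"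
    using T s0 by (simp add: g_def field_simps)
  have "card I = card J + card {i \<in> I. g < real (gap U (f i))}"
    unfolding J_def by (subst card_Un_disjoint[symmetric]) (use assms in \<open>auto intro!: arg_cong[of _ _ card]\<close>)
  then have half: "T / 2 \<le> real (card J)" using bad' by (simp add: T_def)
  have "real (card J) \<le> k * real (card {p \<in> U \<times> U. fst p < snd p \<and> real (gap U p) \<le> g})"
  proof (rule card_le_fibres[where f = f])
    show "finite J" using assms by (simp add: J_def)
    show "real (card {j \<in> J. f j = f i}) \<le> k" if "i \<in> J" for i
    proof -
      have "card {j \<in> J. f j = f i} \<le> card {j \<in> I. f j = f i}"
        by (rule card_mono) (use assms in \<open>auto simp: J_def\<close>)
      then show ?thesis using k(1)[of i] that by (auto simp: J_def)
    qed
    show "f ` J \<subseteq> {p \<in> U \<times> U. fst p < snd p \<and> real (gap U p) \<le> g}"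
      by (intro image_subsetI) (use f in \<open>simp add: J_def\<close>)
  qed (use assms in auto)
  also have "\<dots> \<le> k * (real (card U) * g)"
    by (intro mult_left_mono card_close_pairs assms k) (use T s0 in \<open>simp add: g_def\<close>)
  finally have "T * real (card J) \<le> 2 * k * real (card U) * s"
    using T by (simp add: g_def field_simps)
  moreover have "T * (T / 2) \<le> T * real (card J)"
    using half T by (intro mult_left_mono) auto
  ultimately show ?thesis by (simp add: T_def[symmetric] power2_eq_square algebra_simps)
qed

text \<open>As before, but with four times the average as threshold in each coordinate: each
  condition loses at most a quarter of \<open>I\<close>, so half of it satisfies both.\<close>

lemma two_gap_count:
  fixes f h :: "'i \<Rightarrow> real \<times> real"
  assumes "finite I" "finite U" "finite V"
    and f: "\<And>i. i \<in> I \<Longrightarrow> f i \<in> U \<times> U \<and> fst (f i) < snd (f i)"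
    and h: "\<And>i. i \<in> I \<Longrightarrow> h i \<in> V \<times> V \<and> fst (h i) < snd (h i)"
    and s: "(\<Sum>i\<in>I. real (gap U (f i))) \<le> s"
    and r: "(\<Sum>i\<in>I. real (gap V (h i))) \<le> r"
    and k: "\<And>i. i \<in> I \<Longrightarrow> real (card {j \<in> I. f j = f i \<and> h j = h i}) \<le> k" "0 \<le> k"
  shows "real (card I) ^ 3 \<le> 32 * k * real (card U) * real (card V) * s * r"
proof (cases "I = {}")
  case True
  then show ?thesis using s r k by simp
next
  case False
  define T where "T = real (card I)"
  have T: "T > 0" using False assms(1) by (simp add: T_def card_gt_0_iff)
  have s0: "T \<le> s" using card_le_sum_gap[OF assms(2) f s] by (simp add: T_def)
  have r0: "T \<le> r" using card_le_sum_gap[OF assms(3) h r] by (simp add: T_def)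
  define g where "g = 4 * s / T"
  define g' where "g' = 4 * r / T"
  define J where "J = {i \<in> I. real (gap U (f i)) \<le> g \<and> real (gap V (h i)) \<le> g'}"
  let ?B = "{i \<in> I. g < real (gap U (f i))}" and ?B' = "{i \<in> I. g' < real (gap V (h i))}"
  have "g * real (card ?B) \<le> s" "g' * real (card ?B') \<le> r"
    using markov_count[OF assms(1) _ s] markov_count[OF assms(1) _ r] by simp_all
  then have bad: "real (card ?B) \<le> T / 4" "real (card ?B') \<le> T / 4"
    using T s0 r0 by (simp_all add: g_def g'_def field_simps)
  have "I \<subseteq> J \<union> (?B \<union> ?B')" by (auto simp: J_def)
  then have "card I \<le> card (J \<union> (?B \<union> ?B'))"
    by (rule card_mono[rotated]) (use assms in \<open>auto simp: J_def\<close>)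
  also have "\<dots> \<le> card J + (card ?B + card ?B')"
    by (meson add_left_mono card_Un_le order_trans)
  finally have half: "T / 2 \<le> real (card J)" using bad by (simp add: T_def)
  let ?P = "\<lambda>U g. {p \<in> U \<times> U. fst p < snd p \<and> real (gap U p) \<le> g}"
  have "real (card J) \<le> k * real (card (?P U g \<times> ?P V g'))"
  proof (rule card_le_fibres[where f = "\<lambda>i. (f i, h i)"])
    show "finite J" using assms by (simp add: J_def)
    show "real (card {j \<in> J. (f j, h j) = (f i, h i)}) \<le> k" if "i \<in> J" for i
    proof -
      have "card {j \<in> J. (f j, h j) = (f i, h i)} \<le> card {j \<in> I. f j = f i \<and> h j = h i}"
        by (rule card_mono) (use assms in \<open>auto simp: J_def\<close>)
      then show ?thesis using k(1)[of i] that by (auto simp: J_def)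
    qed
    show "(\<lambda>i. (f i, h i)) ` J \<subseteq> ?P U g \<times> ?P V g'"
      by (intro image_subsetI) (use f h in \<open>simp add: J_def\<close>)
  qed (use assms in auto)
  also have "\<dots> \<le> k * ((real (card U) * g) * (real (card V) * g'))"
    unfolding card_cartesian_product of_nat_mult
    by (intro mult_left_mono mult_mono card_close_pairs assms k)
      (use T s0 r0 in \<open>simp_all add: g_def g'_def\<close>)
  finally have "T * T * real (card J) \<le> 16 * k * real (card U) * real (card V) * s * r"
    using T by (simp add: g_def g'_def field_simps)
  moreover have "T * T * (T / 2) \<le> T * T * real (card J)"
    using half T by (intro mult_left_mono) auto
  ultimately show ?thesis by (simp add: T_def[symmetric] power3_eq_cube algebra_simps)
qed

section \<open>Rich lines in grids\<close>

text \<open>A line is the pair (slope, intercept), and a point on it is recorded by its abscissa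
  alone.\<close>

definition line_pts :: "real set \<Rightarrow> real set \<Rightarrow> real \<times> real \<Rightarrow> real set" where
  "line_pts X Y l = {u \<in> X. fst l * u + snd l \<in> Y}"

lemma finite_line_pts [simp]: "finite X \<Longrightarrow> finite (line_pts X Y l)"
  by (simp add: line_pts_def)

text \<open>A Szemeredi-Trotter bound by squeezing. Neighbouring incidences on a line give a pair in
  \<open>X\<close> and, the slope being positive, an increasing pair in \<open>Y\<close>. Per line
  the gaps add up to at most \<open>card X\<close> and \<open>card Y\<close>.\<close>

lemma sum_incidences_rich_lines:
  assumes fin: "finite X" "finite Y" "finite L"
    and slope: "\<And>l. l \<in> L \<Longrightarrow> 0 < fst l"
    and rich: "\<And>l. l \<in> L \<Longrightarrow> \<rho> \<le> real (card (line_pts X Y l))" and "2 \<le> \<rho>"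
  shows "\<rho>\<^sup>2 * (\<Sum>l\<in>L. real (card (line_pts X Y l))) \<le> 256 * real (card X) ^ 2 * real (card Y) ^ 2"
proof -
  let ?S = "line_pts X Y"
  define I where "I = Sigma L (\<lambda>l. consec (?S l))"
  define h where "h = (\<lambda>(l :: real \<times> real, p :: real \<times> real).
    (fst l * fst p + snd l, fst l * snd p + snd l))"
  define R where "R = (\<Sum>l\<in>L. real (card (?S l)))"
  define T where "T = real (card I)"
  have finI: "finite I" using fin by (simp add: I_def)
  \<comment> \<open>A line with at least two points has at least half as many consecutive pairs as
    points; this is where \<open>2 \<le> \<rho>\<close> enters.\<close>
  have "R \<le> (\<Sum>l\<in>L. 2 * real (card (consec (?S l))))"
    unfolding R_def
  proof (rule sum_mono)
    fix l assume l: "l \<in> L"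
    have "real (card (?S l)) \<le> real (card (consec (?S l))) + 1"
      using card_le_card_consec[of "?S l"] fin by simp
    then show "real (card (?S l)) \<le> 2 * real (card (consec (?S l)))"
      using rich[OF l] \<open>2 \<le> \<rho>\<close> by linarith
  qed
  then have RT: "R \<le> 2 * T"
    using fin by (simp add: T_def I_def card_SigmaI sum_distrib_left)
  \<comment> \<open>Richness bounds the number of lines by incidences; substituted into the cubic
    inequality, it leaves a bound linear in \<open>T\<close> after cancelling
    \<open>T\<^sup>2\<close>.\<close>
  have RL: "\<rho> * real (card L) \<le> R"
    unfolding R_def using sum_mono[of L "\<lambda>_. \<rho>"] rich by (simp add: mult.commute)
  have "T ^ 3 \<le> 32 * 1 * real (card X) * real (card Y) * (real (card L) * real (card X)) * (real (card L) * real (card Y))"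
    unfolding T_def
  proof (rule two_gap_count[where f = snd and h = h])
    show "snd i \<in> X \<times> X \<and> fst (snd i) < snd (snd i)" if "i \<in> I" for i
      using that by (auto simp: I_def consec_def line_pts_def)
    show "h i \<in> Y \<times> Y \<and> fst (h i) < snd (h i)" if "i \<in> I" for i
      using that slope by (auto simp: I_def consec_def line_pts_def h_def)
    have "(\<Sum>p\<in>consec (?S l). gap X p) \<le> card X" for l
      using sum_gap_consec[of "?S l" X "\<lambda>u. u" X] fin by (simp add: case_prod_unfold)
    then have "(\<Sum>l\<in>L. \<Sum>p\<in>consec (?S l). gap X p) \<le> (\<Sum>l\<in>L. card X)"
      by (rule sum_mono)
    then have "(\<Sum>i\<in>I. gap X (snd i)) \<le> card L * card X"
      unfolding I_def using fin by (simp add: sum.Sigma case_prod_unfold)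
    then show "(\<Sum>i\<in>I. real (gap X (snd i))) \<le> real (card L) * real (card X)"
      by (simp flip: of_nat_mult of_nat_sum)
    have "(\<Sum>p\<in>consec (?S l). gap Y (h (l, p))) \<le> card Y" if "l \<in> L" for l
      using sum_gap_consec[of "?S l" Y "\<lambda>u. fst l * u + snd l" Y] fin slope[OF that]
      by (simp add: case_prod_unfold h_def)
    then have "(\<Sum>l\<in>L. \<Sum>p\<in>consec (?S l). gap Y (h (l, p))) \<le> (\<Sum>l\<in>L. card Y)"
      by (rule sum_mono)
    then have "(\<Sum>i\<in>I. gap Y (h i)) \<le> card L * card Y"
      unfolding I_def using fin by (simp add: sum.Sigma)
    then show "(\<Sum>i\<in>I. real (gap Y (h i))) \<le> real (card L) * real (card Y)"
      by (simp flip: of_nat_mult of_nat_sum)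
    \<comment> \<open>Both coordinate pairs together give two distinct points, which determine the
      line.\<close>
    show "real (card {j \<in> I. snd j = snd i \<and> h j = h i}) \<le> 1" if "i \<in> I" for i
    proof -
      have "j = i" if j: "j \<in> I" and eq: "snd j = snd i" "h j = h i" for j
      proof -
        obtain m c m' c' a b where ij: "i = ((m, c), (a, b))" "j = ((m', c'), (a, b))"
          using eq by (metis prod.collapse)
        have "a < b" using j by (auto simp: I_def consec_def ij)
        have *: "m' * a + c' = m * a + c" "m' * b + c' = m * b + c"
          using eq by (auto simp: h_def ij)
        then have "(m' - m) * (b - a) = 0" by (simp add: algebra_simps)
        then have "m' = m" using \<open>a < b\<close> by simp
        then show ?thesis using * ij by simp
      qed
      then have "{j \<in> I. snd j = snd i \<and> h j = h i} \<subseteq> {i}" by blast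
      then have "card {j \<in> I. snd j = snd i \<and> h j = h i} \<le> card {i}" by (intro card_mono) auto
      then show ?thesis by simp
    qed
  qed (use fin finI in auto)
  then have "\<rho>\<^sup>2 * T ^ 3 \<le> \<rho>\<^sup>2 * (32 * (real (card X) * real (card Y) * real (card L))\<^sup>2)"
    by (intro mult_left_mono) (simp_all add: power2_eq_square mult_ac)
  also have "\<dots> = 32 * (real (card X) * real (card Y))\<^sup>2 * (\<rho> * real (card L))\<^sup>2"
    by (simp add: power2_eq_square mult_ac)
  also have "\<dots> \<le> 32 * (real (card X) * real (card Y))\<^sup>2 * (2 * T)\<^sup>2"
    using RL RT \<open>2 \<le> \<rho>\<close> by (intro mult_left_mono power_mono) auto
  finally have main: "T\<^sup>2 * (\<rho>\<^sup>2 * T) \<le> T\<^sup>2 * (128 * (real (card X) * real (card Y))\<^sup>2)"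
    by (simp add: power2_eq_square power3_eq_cube mult_ac)
  have "\<rho>\<^sup>2 * T \<le> 128 * (real (card X) * real (card Y))\<^sup>2"
  proof (cases "T = 0")
    case False
    then show ?thesis using main by (simp add: mult_le_cancel_left)
  qed simp
  moreover have "\<rho>\<^sup>2 * R \<le> \<rho>\<^sup>2 * (2 * T)" using RT by (intro mult_left_mono) auto
  ultimately show ?thesis by (simp add: R_def power_mult_distrib)
qed

section \<open>From incidences to popular quotients\<close>

lemma prodset_eq_image: "prodset A B = (\<lambda>(a, b). a * b) ` (A \<times> B)"
  by (auto simp: prodset_def)

lemma finite_prodset [simp]: "finite A \<Longrightarrow> finite B \<Longrightarrow> finite (prodset A B)"
  by (simp add: prodset_eq_image)

text \<open>The number of representations \<open>x = (a + 1) / (b + 1)\<close> with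
  \<open>a\<close>, \<open>b\<close> in \<open>A\<close> positive, counted by \<open>b\<close>
  because \<open>a = x * (b + 1) - 1\<close>.\<close>

definition quot_count :: "real set \<Rightarrow> real \<Rightarrow> nat" where
  "quot_count A x = card {b \<in> A. x * (b + 1) - 1 \<in> A}"

text \<open>Richness in the grid of \<open>prodset A A\<close> bounds the number of distinct lines.
  Several triples can share a line, so the multiplicities have to be summed; they are bounded by
  incidences of the reflected lines with \<open>A \<times> A\<close>, to which the same incidence
  bound applies.\<close>

lemma card_popular_quotients:
  assumes A: "finite A" "\<And>a. a \<in> A \<Longrightarrow> 0 < a"
    and P: "finite P" "1 \<notin> P" "\<And>x. x \<in> P \<Longrightarrow> 0 < x"
    and pop: "\<And>x. x \<in> P \<Longrightarrow> \<tau> \<le> real (quot_count A x)" and "2 \<le> \<tau>"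
  shows "\<tau>\<^sup>2 * (real (card P) * real (card A) ^ 2)
    \<le> 256 * (real (card (prodset A A)) ^ 4 + real (card A) ^ 4)"
proof -
  let ?X = "prodset A A"
  define g where "g = (\<lambda>(x :: real, h :: real, h' :: real). (x * h' / h, (x - 1) * h'))"
  define D where "D = P \<times> A \<times> A"
  define L where "L = g ` D"
  define mirror where "mirror = (\<lambda>l :: real \<times> real. (fst l, - snd l))"
  let ?w = "\<lambda>l. real (card (line_pts A A (mirror l)))"
  have finX: "finite ?X" using A by simp
  have finD: "finite D" using A P by (simp add: D_def)
  have finL: "finite L" using finD by (simp add: L_def)
  have slope: "0 < fst l" if "l \<in> L" for l
    using that A P by (force simp: L_def D_def g_def)
  have richX: "\<tau> \<le> real (card (line_pts ?X ?X l))" if l: "l \<in> L" for l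
  proof -
    obtain x h h' where d: "x \<in> P" "h \<in> A" "h' \<in> A" and l: "l = (x * h' / h, (x - 1) * h')"
      using l by (auto simp: L_def D_def g_def)
    have h: "0 < h" using A d by auto
    have "card {b \<in> A. x * (b + 1) - 1 \<in> A} \<le> card (line_pts ?X ?X l)"
    proof (rule card_inj_on_le[where f = "\<lambda>b. b * h"])
      show "(\<lambda>b. b * h) ` {b \<in> A. x * (b + 1) - 1 \<in> A} \<subseteq> line_pts ?X ?X l"
      proof clarify
        fix b assume b: "b \<in> A" "x * (b + 1) - 1 \<in> A"
        have "x * h' / h * (b * h) + (x - 1) * h' = (x * (b + 1) - 1) * h'"
          using h by (simp add: field_simps)
        then show "b * h \<in> line_pts ?X ?X l"
          using b d by (auto simp: line_pts_def l prodset_def)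
      qed
    qed (use h finX in \<open>auto simp: inj_on_def\<close>)
    then show ?thesis using pop[OF d(1)] by (simp add: quot_count_def)
  qed
  have "\<tau>\<^sup>2 * (\<tau> * real (card L)) \<le> \<tau>\<^sup>2 * (\<Sum>l\<in>L. real (card (line_pts ?X ?X l)))"
    using sum_mono[of L "\<lambda>_. \<tau>"] richX by (intro mult_left_mono) (auto simp: mult.commute)
  also have "\<dots> \<le> 256 * real (card ?X) ^ 2 * real (card ?X) ^ 2"
    by (rule sum_incidences_rich_lines) (use finX finL slope richX \<open>2 \<le> \<tau>\<close> in auto)
  finally have cardL: "\<tau>\<^sup>2 * (\<tau> * real (card L)) \<le> 256 * real (card ?X) ^ 4"
    by (simp add: power4_eq_xxxx power2_eq_square mult_ac)
  \<comment> \<open>On a given line, \<open>h\<close> determines the triple: \<open>h'\<close> is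
    slope times \<open>h\<close> minus intercept, and then \<open>x\<close> follows from the
    intercept.\<close>
  have fibre: "real (card {d \<in> D. g d = l}) \<le> ?w l" for l
  proof -
    have "card {d \<in> D. g d = l} \<le> card (line_pts A A (mirror l))"
    proof (rule card_inj_on_le[where f = "\<lambda>(x, h, h'). h"])
      have *: "h' = fst l * h - snd l" "x = 1 + snd l / h'" "h \<in> A" "h' \<in> A"
        if "(x, h, h') \<in> D" "g (x, h, h') = l" for x h h'
        using that A P(2) by (force simp: D_def g_def field_simps)+
      show "inj_on (\<lambda>(x, h, h'). h) {d \<in> D. g d = l}"
        by (rule inj_onI) (use * in \<open>clarsimp, metis\<close>)
      show "(\<lambda>(x, h, h'). h) ` {d \<in> D. g d = l} \<subseteq> line_pts A A (mirror l)"
        using * by (fastforce simp: line_pts_def mirror_def)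
    qed (use A in simp)
    then show ?thesis by simp
  qed
  have "real (card D) = (\<Sum>l\<in>L. real (card {d \<in> D. g d = l}))"
    using sum.group[of D L g "\<lambda>_. 1 :: real"] finD finL by (simp add: L_def)
  also have "\<dots> \<le> (\<Sum>l\<in>L. ?w l)" by (intro sum_mono fibre)
  \<comment> \<open>Lines whose reflection has fewer than \<tau> points are charged \<tau> each and
    paid for by \<open>cardL\<close>; the other reflections are \<tau>-rich in
    \<open>A \<times> A\<close>.\<close>
  also have "\<dots> = (\<Sum>l\<in>{l \<in> L. ?w l < \<tau>}. ?w l) + (\<Sum>l\<in>{l \<in> L. \<not> ?w l < \<tau>}. ?w l)"
    using finL by (subst sum.union_disjoint[symmetric]) (auto intro!: sum.cong)
  also have "(\<Sum>l\<in>{l \<in> L. ?w l < \<tau>}. ?w l) \<le> (\<Sum>l\<in>{l \<in> L. ?w l < \<tau>}. \<tau>)"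
    by (intro sum_mono) auto
  also have "\<dots> \<le> \<tau> * real (card L)"
    using finL \<open>2 \<le> \<tau>\<close> by (simp add: mult.commute card_mono mult_left_mono)
  finally have cardD: "real (card D) \<le> \<tau> * real (card L) + (\<Sum>l\<in>{l \<in> L. \<not> ?w l < \<tau>}. ?w l)"
    by simp
  let ?M = "{l \<in> L. \<not> ?w l < \<tau>}"
  have inj: "inj_on mirror ?M" by (auto simp: inj_on_def mirror_def prod_eq_iff)
  have "\<tau>\<^sup>2 * (\<Sum>l\<in>mirror ` ?M. real (card (line_pts A A l))) \<le> 256 * real (card A) ^ 2 * real (card A) ^ 2"
    by (rule sum_incidences_rich_lines) (use A finL slope \<open>2 \<le> \<tau>\<close> in \<open>auto simp: mirror_def\<close>)
  then have "\<tau>\<^sup>2 * (\<Sum>l\<in>?M. ?w l) \<le> 256 * real (card A) ^ 4"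
    by (simp add: sum.reindex[OF inj] power4_eq_xxxx power2_eq_square mult_ac)
  moreover have "\<tau>\<^sup>2 * real (card D) \<le> \<tau>\<^sup>2 * (\<tau> * real (card L) + (\<Sum>l\<in>?M. ?w l))"
    using cardD by (intro mult_left_mono) auto
  ultimately have "\<tau>\<^sup>2 * real (card D) \<le> 256 * real (card ?X) ^ 4 + 256 * real (card A) ^ 4"
    using cardL by (simp add: distrib_left)
  then show ?thesis by (simp add: D_def card_cartesian_product power2_eq_square)
qed

section \<open>Multiplicative energy of a shifted set\<close>

lemma card_collisions:
  assumes "finite P"
  shows "real (card {(p, q) \<in> P \<times> P. f p = f q}) = (\<Sum>z\<in>f ` P. real (card {p \<in> P. f p = z}) ^ 2)"
proof -
  let ?C = "{(p, q) \<in> P \<times> P. f p = f q}"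
  have fin: "finite ?C" by (rule finite_subset[of _ "P \<times> P"]) (use assms in auto)
  have "real (card ?C) = (\<Sum>z\<in>f ` P. real (card {c \<in> ?C. f (fst c) = z}))"
    using sum.group[of ?C "f ` P" "\<lambda>c. f (fst c)" "\<lambda>_. 1 :: real"] fin assms by force
  also have "\<dots> = (\<Sum>z\<in>f ` P. real (card {p \<in> P. f p = z}) ^ 2)"
  proof (rule sum.cong)
    fix z
    have "{c \<in> ?C. f (fst c) = z} = {p \<in> P. f p = z} \<times> {p \<in> P. f p = z}" by auto
    then show "real (card {c \<in> ?C. f (fst c) = z}) = real (card {p \<in> P. f p = z}) ^ 2"
      by (simp add: card_cartesian_product power2_eq_square)
  qed simp
  finally show ?thesis .
qed

text \<open>Cauchy-Schwarz over the fibres of \<open>f\<close>.\<close>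

lemma card_square_le_collisions:
  assumes "finite P"
  shows "real (card P) ^ 2 \<le> real (card (f ` P)) * real (card {(p, q) \<in> P \<times> P. f p = f q})"
proof -
  have "real (card P) = (\<Sum>z\<in>f ` P. real (card {p \<in> P. f p = z}))"
    using sum.group[of P "f ` P" f "\<lambda>_. 1 :: real"] assms by simp
  then show ?thesis
    using sum_squared_le_sum_of_squares[of "\<lambda>z. real (card {p \<in> P. f p = z})" "f ` P"]
    by (simp only: card_collisions[OF assms] mult.commute)
qed

section \<open>Summation over popularity levels and the energy bound\<close>

lemma sum_inverse_le_ln:
  assumes "1 \<le> N"
  shows "(\<Sum>t = 1..N. 1 / real t) \<le> 1 + ln (real N)"
  using assms
proof (induction N rule: dec_induct)
  case (step n)
  have "ln (real n / real (Suc n)) \<le> real n / real (Suc n) - 1"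
    using step.hyps by (intro ln_le_minus_one) auto
  then have "1 / real (Suc n) \<le> ln (real (Suc n)) - ln (real n)"
    using step.hyps by (simp add: ln_div field_simps)
  then show ?case using step.IH by simp
qed simp

text \<open>Layer-cake summation: level \<open>t\<close> has at most
  \<open>512 * K ^ 4 * N\<^sup>2 / t\<^sup>2\<close> quotients and weight \<open>2 * t\<close>,
  which leaves a harmonic sum and hence the logarithm.\<close>

lemma sum_quot_count_square:
  assumes A: "finite A" "A \<noteq> {}" "\<And>a. a \<in> A \<Longrightarrow> 0 < a" and "1 \<le> K"
    and K: "real (card (prodset A A)) \<le> K * real (card A)"
    and Q: "finite Q" "1 \<notin> Q" "\<And>x. x \<in> Q \<Longrightarrow> 0 < x" "real (card Q) \<le> real (card A) ^ 2"
  shows "(\<Sum>x\<in>Q. real (quot_count A x) ^ 2)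
    \<le> 1024 * K ^ 4 * real (card A) ^ 2 * (1 + ln (real (card A)))"
proof -
  define N where "N = card A"
  have N: "1 \<le> N" using A by (simp add: N_def Suc_le_eq card_gt_0_iff)
  have K4: "1 \<le> K ^ 4" using \<open>1 \<le> K\<close> by simp
  let ?P = "\<lambda>t. {x \<in> Q. t \<le> quot_count A x}"
  have le_N: "quot_count A x \<le> N" for x
    unfolding quot_count_def N_def using A by (intro card_mono) auto
  have tail: "real t ^ 2 * real (card (?P t)) \<le> 512 * K ^ 4 * real N ^ 2" if "1 \<le> t" for t
  \<comment> \<open>The incidence argument needs popularity at least 2; level 1 is covered by the
    assumed size of \<open>Q\<close>.\<close>
  proof (cases "t = 1")
    case True
    have "real (card (?P 1)) \<le> real N ^ 2"
      using card_mono[of Q "?P 1"] Q by (force simp: N_def)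
    also have "\<dots> \<le> 512 * K ^ 4 * real N ^ 2"
      using K4 by (simp add: mult_le_cancel_right1)
    finally show ?thesis using True by simp
  next
    case False
    have "real t ^ 2 * (real (card (?P t)) * real N ^ 2)
        \<le> 256 * (real (card (prodset A A)) ^ 4 + real N ^ 4)"
      unfolding N_def by (rule card_popular_quotients) (use A Q that False in auto)
    also have "\<dots> \<le> 256 * ((K * real N) ^ 4 + K ^ 4 * real N ^ 4)"
      using K K4 by (intro mult_left_mono add_mono power_mono) (auto simp: N_def mult_le_cancel_right1)
    finally have "real N ^ 2 * (real t ^ 2 * real (card (?P t))) \<le> real N ^ 2 * (512 * K ^ 4 * real N ^ 2)"
      by (simp add: power_mult_distrib power4_eq_xxxx power2_eq_square mult_ac)
    then show ?thesis using N by simp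
  qed
  have layer: "real m ^ 2 \<le> (\<Sum>t = 1..N. if t \<le> m then 2 * real t else 0)" if "m \<le> N" for m
  proof -
    have "real m ^ 2 \<le> (\<Sum>t = 1..m. 2 * real t)"
      by (induction m) (auto simp: power2_eq_square algebra_simps)
    also have "\<dots> = (\<Sum>t = 1..N. if t \<le> m then 2 * real t else 0)"
      using that by (intro sum.mono_neutral_cong_left) auto
    finally show ?thesis .
  qed
  have "(\<Sum>x\<in>Q. real (quot_count A x) ^ 2)
      \<le> (\<Sum>x\<in>Q. \<Sum>t = 1..N. if t \<le> quot_count A x then 2 * real t else 0)"
    by (intro sum_mono layer le_N)
  also have "\<dots> = (\<Sum>t = 1..N. \<Sum>x\<in>Q. if t \<le> quot_count A x then 2 * real t else 0)"
    by (rule sum.swap)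
  also have "\<dots> = (\<Sum>t = 1..N. 2 * real t * real (card (?P t)))"
    by (intro sum.cong refl) (use Q in \<open>simp add: sum.If_cases Int_def mult.commute\<close>)
  also have "\<dots> \<le> (\<Sum>t = 1..N. 1024 * K ^ 4 * real N ^ 2 * (1 / real t))"
  proof (rule sum_mono)
    fix t assume "t \<in> {1..N}"
    then show "2 * real t * real (card (?P t)) \<le> 1024 * K ^ 4 * real N ^ 2 * (1 / real t)"
      using tail[of t] by (simp add: field_simps power2_eq_square)
  qed
  also have "\<dots> = 1024 * K ^ 4 * real N ^ 2 * (\<Sum>t = 1..N. 1 / real t)"
    by (simp add: sum_distrib_left)
  also have "\<dots> \<le> 1024 * K ^ 4 * real N ^ 2 * (1 + ln (real N))"
    using K4 by (intro mult_left_mono sum_inverse_le_ln N) auto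
  finally show ?thesis by (simp add: N_def)
qed

text \<open>Cauchy-Schwarz reduces the claim to the multiplicative energy. Moving factors across
  \<open>(a + 1) * (b + 1) = (c + 1) * (d + 1)\<close> turns product collisions into quotient
  collisions, whose number is the sum of squares of \<open>quot_count\<close>.\<close>

lemma card_prodset_shift1:
  assumes A: "finite A" "A \<noteq> {}" "\<And>a. a \<in> A \<Longrightarrow> 0 < a" and "1 \<le> K"
    and K: "real (card (prodset A A)) \<le> K * real (card A)"
  shows "real (card A) ^ 2
    \<le> 1025 * K ^ 4 * (1 + ln (real (card A))) * real (card (prodset (shift1 A) (shift1 A)))"
proof -
  define N where "N = card A"
  have N: "1 \<le> N" using A by (simp add: N_def Suc_le_eq card_gt_0_iff)
  have K4: "1 \<le> K ^ 4" using \<open>1 \<le> K\<close> by simp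
  define L where "L = 1 + ln (real N)"
  have L: "1 \<le> L" using N by (simp add: L_def)
  define p where "p = (\<lambda>(a :: real, b :: real). (a + 1) * (b + 1))"
  define q where "q = (\<lambda>(a :: real, b :: real). (a + 1) / (b + 1))"
  let ?coll = "\<lambda>f :: real \<times> real \<Rightarrow> real. {(u, v) \<in> (A \<times> A) \<times> (A \<times> A). f u = f v}"
  have finAA: "finite (A \<times> A)" using A by simp
  have BB: "p ` (A \<times> A) = prodset (shift1 A) (shift1 A)"
    by (auto simp: prodset_def shift1_def p_def image_def)
  have fin: "finite (?coll p)" "finite (?coll q)"
    by (rule finite_subset[OF _ finite_cartesian_product[OF finAA finAA]]; auto)+
  have "card (?coll p) \<le> card (?coll q)"
  proof (rule card_inj_on_le[where f = "\<lambda>((a, b), (c, d)). ((a, c), (d, b))"])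
    have "q (a, c) = q (d, b)"
      if "a \<in> A" "b \<in> A" "c \<in> A" "d \<in> A" "p (a, b) = p (c, d)" for a b c d
      using that A(3)[of b] A(3)[of c] by (simp add: p_def q_def frac_eq_eq mult.commute)
    then show "(\<lambda>((a, b), (c, d)). ((a, c), (d, b))) ` ?coll p \<subseteq> ?coll q" by auto
  qed (use fin in \<open>auto simp: inj_on_def\<close>)
  also have "real (card (?coll q)) = (\<Sum>x\<in>q ` (A \<times> A). real (card {u \<in> A \<times> A. q u = x}) ^ 2)"
    by (rule card_collisions[OF finAA])
  also have "\<dots> = (\<Sum>x\<in>q ` (A \<times> A). real (quot_count A x) ^ 2)"
  proof (rule sum.cong)
    fix x
    have "bij_betw snd {u \<in> A \<times> A. q u = x} {b \<in> A. x * (b + 1) - 1 \<in> A}"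
    proof (rule bij_betw_byWitness[where f' = "\<lambda>b. (x * (b + 1) - 1, b)"])
      have nz: "b + 1 \<noteq> 0" if "b \<in> A" for b using A(3)[OF that] by simp
      show "\<forall>u\<in>{u \<in> A \<times> A. q u = x}. (x * (snd u + 1) - 1, snd u) = u"
        using nz by (auto simp: q_def)
      show "snd ` {u \<in> A \<times> A. q u = x} \<subseteq> {b \<in> A. x * (b + 1) - 1 \<in> A}"
        using nz by (auto simp: q_def)
      show "(\<lambda>b. (x * (b + 1) - 1, b)) ` {b \<in> A. x * (b + 1) - 1 \<in> A} \<subseteq> {u \<in> A \<times> A. q u = x}"
        using nz by (auto simp: q_def)
    qed simp
    then show "real (card {u \<in> A \<times> A. q u = x}) ^ 2 = real (quot_count A x) ^ 2"
      using bij_betw_same_card by (fastforce simp: quot_count_def)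
  qed simp
  \<comment> \<open>The quotient 1 has exactly \<open>N\<close> representations and is split off;
    its square accounts for the step from 1024 to 1025.\<close>
  also have "\<dots> \<le> real N ^ 2 + (\<Sum>x\<in>q ` (A \<times> A) - {1}. real (quot_count A x) ^ 2)"
  proof -
    have "1 \<in> q ` (A \<times> A)"
    proof -
      obtain a where "a \<in> A" using A by auto
      then have "q (a, a) = 1" using A(3)[of a] by (simp add: q_def)
      then show ?thesis using \<open>a \<in> A\<close> by (force simp: image_iff)
    qed
    then show ?thesis
      using A by (subst sum.remove[of _ 1]) (auto simp: quot_count_def N_def)
  qed
  also have "\<dots> \<le> real N ^ 2 + 1024 * K ^ 4 * real N ^ 2 * L"
  proof -
    have "real (card (q ` (A \<times> A) - {1})) \<le> real (card A) ^ 2"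
    proof -
      have "card (q ` (A \<times> A) - {1}) \<le> card (q ` (A \<times> A))" using finAA by (intro card_mono) auto
      also have "\<dots> \<le> card (A \<times> A)" by (rule card_image_le[OF finAA])
      finally have "real (card (q ` (A \<times> A) - {1})) \<le> real (card (A \<times> A))" by simp
      then show ?thesis by (simp add: card_cartesian_product power2_eq_square)
    qed
    then show ?thesis
      unfolding N_def L_def
      by (intro add_left_mono sum_quot_count_square[OF A \<open>1 \<le> K\<close> K])
        (use A in \<open>auto simp: q_def add_pos_pos\<close>)
  qed
  also have "\<dots> \<le> 1025 * K ^ 4 * L * real N ^ 2"
  proof -
    have "1 * 1 \<le> K ^ 4 * L" using K4 L by (intro mult_mono) auto
    then have "1 * real N ^ 2 \<le> K ^ 4 * L * real N ^ 2" by (intro mult_right_mono) auto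
    then show ?thesis by (simp add: algebra_simps)
  qed
  finally have E: "real (card (?coll p)) \<le> 1025 * K ^ 4 * L * real N ^ 2" by simp
  have "real N ^ 2 * real N ^ 2 = real (card (A \<times> A)) ^ 2"
    by (simp add: N_def card_cartesian_product power2_eq_square)
  also have "\<dots> \<le> real (card (p ` (A \<times> A))) * real (card (?coll p))"
    by (rule card_square_le_collisions[OF finAA])
  also have "\<dots> \<le> real (card (p ` (A \<times> A))) * (1025 * K ^ 4 * L * real N ^ 2)"
    by (intro mult_left_mono E) auto
  finally have "real N ^ 2 * real N ^ 2 \<le> real N ^ 2 * (1025 * K ^ 4 * L * real (card (p ` (A \<times> A))))"
    by (simp add: mult_ac)
  then have "real N ^ 2 \<le> 1025 * K ^ 4 * L * real (card (p ` (A \<times> A)))"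
    by (rule mult_left_le_imp_le) (use N in simp)
  then show ?thesis by (simp add: BB N_def L_def)
qed

section \<open>Squeezing products with a shifted set\<close>

lemma sum_gap_scaled:
  assumes "finite A" "finite S" "S \<subseteq> A" "b \<in> A" "0 < b"
  shows "(\<Sum>p\<in>consec S. gap (prodset A A) (b * fst p, b * snd p)) \<le> card (prodset A A)"
  using sum_gap_consec[of S "prodset A A" "\<lambda>a. b * a" "prodset A A"] assms
  by (simp add: case_prod_unfold)

text \<open>Squeeze the pairs \<open>(b * a, b * a')\<close> inside \<open>prodset A A\<close>, for
  \<open>b\<close> in \<open>A\<close> and neighbours \<open>a < a'\<close>. There are at least
  \<open>N\<^sup>2 / 2\<close> of these triples. If every ratio were rare, each pair would arise so
  seldom that their number squared is at most \<open>N ^ 4 / 8\<close>, less than the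
  \<open>N ^ 4 / 4\<close> just found.\<close>

lemma popular_consecutive_ratio:
  assumes A: "finite A" "\<And>a. a \<in> A \<Longrightarrow> 0 < a" "2 \<le> card A" and "1 \<le> K"
    and K: "real (card (prodset A A)) \<le> K * real (card A)"
  shows "\<exists>d>1. real (card A) \<le> 32 * K\<^sup>2 * real (card {a \<in> A. (a, d * a) \<in> consec A})"
proof (rule ccontr)
  let ?S = "\<lambda>d. {a \<in> A. (a, d * a) \<in> consec A}"
  define N where "N = real (card A)"
  assume "\<not> ?thesis"
  then have no: "32 * K\<^sup>2 * real (card (?S d)) < N" if "1 < d" for d
    using that by (auto simp: N_def not_le)
  have N: "2 \<le> N" using A by (simp add: N_def)
  define I where "I = A \<times> consec A"
  define f where "f = (\<lambda>(b :: real, p). (b * fst p, b * snd p :: real))"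
  have finI: "finite I" using A by (simp add: I_def)
  have I_D: "b \<in> A" "a \<in> A" "a' \<in> A" "a < a'" "0 < b" "0 < a" if "(b, (a, a')) \<in> I" for b a a'
    using that A by (auto simp: I_def consec_def)
  have "real (card I) ^ 2 \<le> 4 * (N / (32 * K\<^sup>2)) * real (card (prodset A A)) * (N * real (card (prodset A A)))"
  proof (rule one_gap_count[where f = f])
    show "f i \<in> prodset A A \<times> prodset A A \<and> fst (f i) < snd (f i)" if "i \<in> I" for i
    proof -
      obtain b a a' where i_eq: "i = (b, (a, a'))" by (metis prod.collapse)
      show ?thesis
        using I_D[OF that[unfolded i_eq]] by (auto simp: i_eq f_def prodset_def)
    qed
    have "(\<Sum>b\<in>A. \<Sum>p\<in>consec A. gap (prodset A A) (f (b, p))) \<le> (\<Sum>b\<in>A. card (prodset A A))"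
      using sum_gap_scaled[of A A] A by (intro sum_mono) (auto simp: f_def)
    then have "(\<Sum>i\<in>I. gap (prodset A A) (f i)) \<le> card A * card (prodset A A)"
      by (simp add: I_def sum.cartesian_product)
    then show "(\<Sum>i\<in>I. real (gap (prodset A A) (f i))) \<le> N * real (card (prodset A A))"
      by (simp add: N_def flip: of_nat_mult of_nat_sum)
    show "real (card {j \<in> I. f j = f i}) \<le> N / (32 * K\<^sup>2)" if i: "i \<in> I" for i
    proof -
      obtain b a a' where i_eq: "i = (b, (a, a'))" by (metis prod.collapse)
      define d where "d = a' / a"
      have d: "1 < d" using I_D[OF i[unfolded i_eq]] by (simp add: d_def)
      \<comment> \<open>The pair fixes the ratio \<open>d\<close>, and then \<open>a1\<close> fixes
        the rest, so a fibre is no larger than the set of neighbours with ratio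
        \<open>d\<close>.\<close>
      have sol: "snd p = d * fst p \<and> b1 = b * a / fst p \<and> fst p \<in> ?S d"
        if "(b1, p) \<in> I" "f (b1, p) = f i" for b1 p
      proof -
        obtain a1 a1' where p: "p = (a1, a1')" by force
        have *: "b1 * a1 = b * a" "b1 * a1' = b * a'" "0 < b1" "0 < a1" "0 < b" "0 < a"
          using that I_D[OF that(1)[unfolded p]] I_D[OF i[unfolded i_eq]] by (auto simp: f_def p i_eq)
        have b1: "b1 = b * a / a1" using *(1,4) by (simp add: eq_divide_eq)
        have "b * (a * a1') = b * (a' * a1)"
          using *(1,2) by algebra
        then have "a1' * a = a' * a1" using *(5) by (simp add: mult.commute)
        then have "a1' = d * a1" using *(6) by (simp add: d_def eq_divide_eq)
        then show ?thesis using that(1) b1 by (auto simp: p I_def consec_def)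
      qed
      have "card {j \<in> I. f j = f i} \<le> card (?S d)"
      proof (rule card_inj_on_le[where f = "\<lambda>j. fst (snd j)"])
        show "inj_on (\<lambda>j. fst (snd j)) {j \<in> I. f j = f i}"
        proof (rule inj_onI)
          fix j j' assume j: "j \<in> {j \<in> I. f j = f i}" and j': "j' \<in> {j \<in> I. f j = f i}"
            and eq: "fst (snd j) = fst (snd j')"
          have "snd (snd k) = d * fst (snd k) \<and> fst k = b * a / fst (snd k)"
            if "k \<in> {j \<in> I. f j = f i}" for k
            using sol[of "fst k" "snd k"] that by simp
          from this[OF j] this[OF j'] eq show "j = j'" by (simp add: prod_eq_iff)
        qed
        show "(\<lambda>j. fst (snd j)) ` {j \<in> I. f j = f i} \<subseteq> ?S d"
        proof (rule image_subsetI)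
          fix j assume "j \<in> {j \<in> I. f j = f i}"
          then show "fst (snd j) \<in> ?S d" using sol[of "fst j" "snd j"] by simp
        qed
      qed (use A in simp)
      then have "real (card {j \<in> I. f j = f i}) \<le> real (card (?S d))" by simp
      also have "\<dots> \<le> N / (32 * K\<^sup>2)" using no[OF d] \<open>1 \<le> K\<close> by (simp add: field_simps)
      finally show ?thesis .
    qed
  qed (use A N finI in auto)
  also have "\<dots> = N\<^sup>2 / (8 * K\<^sup>2) * real (card (prodset A A)) ^ 2"
    by (simp add: power2_eq_square)
  also have "\<dots> \<le> N\<^sup>2 / (8 * K\<^sup>2) * (K * N)\<^sup>2"
    using K by (intro mult_left_mono power_mono) (auto simp: N_def)
  also have "\<dots> = N ^ 4 / 8"
    using \<open>1 \<le> K\<close> by (simp add: power_mult_distrib power2_eq_square power4_eq_xxxx)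
  finally have "real (card I) ^ 2 \<le> N ^ 4 / 8" .
  moreover have "N ^ 4 / 4 \<le> real (card I) ^ 2"
  proof -
    have "N \<le> real (card (consec A)) + 1" using card_le_card_consec[OF A(1)] by (simp add: N_def)
    then have "N * (N / 2) \<le> N * real (card (consec A))" using N by (intro mult_left_mono) auto
    then have "(N * (N / 2))\<^sup>2 \<le> real (card I) ^ 2"
      using N by (intro power_mono) (auto simp: I_def card_cartesian_product N_def)
    then show ?thesis by (simp add: power2_eq_square power4_eq_xxxx)
  qed
  moreover have "0 < N ^ 4" using N by simp
  ultimately show False by linarith
qed

text \<open>By Vieta the roots add up to \<open>- \<beta> / \<alpha>\<close>; naming the other root
  explicitly yields a two-element candidate set.\<close>

lemma quadratic_second_root:
  fixes \<alpha> \<beta> \<gamma> u v :: real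
  assumes "\<alpha> \<noteq> 0" "\<alpha> * u\<^sup>2 + \<beta> * u + \<gamma> = 0" "\<alpha> * v\<^sup>2 + \<beta> * v + \<gamma> = 0"
  shows "v = u \<or> v = - \<beta> / \<alpha> - u"
proof -
  have "(v - u) * (\<alpha> * (v + u) + \<beta>) = 0" using assms(2,3) by algebra
  then have "v = u \<or> \<alpha> * (v + u) + \<beta> = 0" by simp
  then show ?thesis using assms(1) by (auto simp: field_simps)
qed

text \<open>
  Below \<open>G\<close> keeps the pairs \<open>(y, a)\<close> for which \<open>(y (a + 1), y (d a + 1)]\<close> meets \<open>Z\<close> in at most twice the average
  number of points; this confines all \<open>t \<delta>(a)\<close> with \<open>a \<in> S t\<close> to a short window above \<open>t\<close>. The ratio \<open>a' / a\<close> is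
  recorded through the pair \<open>(b a, b a')\<close> in \<open>AA\<close>, whose gap is controlled by the small doubling.
\<close>
lemma card_prodset_shift1_lower:
  assumes A: "finite A" "\<And>a. a \<in> A \<Longrightarrow> 0 < a" "2 \<le> card A" and "1 \<le> K"
    and K: "real (card (prodset A A)) \<le> K * real (card A)"
    and Y: "finite Y" "\<And>y. y \<in> Y \<Longrightarrow> 0 < y"
  shows "(real (card A) * real (card Y)) ^ 3
    \<le> 2 ^ 33 * K ^ 10 * real (card (prodset (shift1 A) Y)) ^ 4"
proof -
  define Z where "Z = prodset (shift1 A) Y"
  define N M m z where "N = real (card A)" and "M = real (card (prodset A A))"
    and "m = real (card Y)" and "z = real (card Z)"
  have N: "2 \<le> N" using A by (simp add: N_def)
  have finZ: "finite Z" using A Y by (simp add: Z_def shift1_def)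
  have ZI: "y * (a + 1) \<in> Z" if "a \<in> A" "y \<in> Y" for a y
    using that by (force simp: Z_def prodset_def shift1_def mult.commute)
  obtain d where d: "1 < d" and A'_large: "N \<le> 32 * K\<^sup>2 * real (card {a \<in> A. (a, d * a) \<in> consec A})"
    using popular_consecutive_ratio[OF A \<open>1 \<le> K\<close> K] unfolding N_def by blast
  define A' where "A' = {a \<in> A. (a, d * a) \<in> consec A}"
  define n where "n = real (card A')"
  have A': "finite A'" "A' \<subseteq> A" using A by (auto simp: A'_def)
  have pos: "0 < a" "d * a \<in> A" if "a \<in> A'" for a
    using that A by (auto simp: A'_def consec_def)
  have Nn: "N \<le> 32 * K\<^sup>2 * n" using A'_large by (simp add: n_def A'_def)
  have n: "0 < n"
  proof (rule ccontr)
    assume "\<not> 0 < n"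
    then have "n = 0" by (simp add: n_def)
    then show False using Nn N by simp
  qed
  have z0: "0 \<le> z" and m0: "0 \<le> m" by (auto simp: z_def m_def)
  define \<delta> where "\<delta> = (\<lambda>a. (d * a + 1) / (a + 1))"
  have \<delta>_mono: "\<delta> a < \<delta> b" if "0 < a" "a < b" for a b
  proof -
    have "0 < (d - 1) * (b - a)" using d that by simp
    then show ?thesis using that by (simp add: \<delta>_def field_simps)
  qed
  have \<delta>_gt: "1 < \<delta> a" if "0 < a" for a
    using d that by (simp add: \<delta>_def field_simps)
  define w where "w = (\<lambda>(y, a). gap Z (y * (a + 1), y * (d * a + 1)))"
  define G where "G = {u \<in> Y \<times> A'. real (w u) \<le> 2 * z / n}"
  have finG: "finite G" using Y A' by (simp add: G_def)
  \<comment> \<open>\<open>S t\<close> collects the \<open>a\<close> that occur in representations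
    \<open>t = y * (a + 1)\<close> with \<open>(y, a)\<close> in \<open>G\<close>; \<open>y\<close>
    is recovered as \<open>t / (a + 1)\<close>.\<close>
  define S where "S = (\<lambda>t. {a \<in> A'. (t / (a + 1), a) \<in> G})"
  have finS: "finite (S t)" for t using A' by (simp add: S_def)
  have S_D: "a \<in> A'" "a \<in> A" "0 < a" "t / (a + 1) \<in> Y" "t * \<delta> a = t / (a + 1) * (d * a + 1)"
    "t = t / (a + 1) * (a + 1)" if "a \<in> S t" for a t
  proof -
    have a: "a \<in> A'" using that by (simp add: S_def)
    then have "a + 1 \<noteq> 0" using pos(1)[of a] by simp
    then show "a \<in> A'" "a \<in> A" "0 < a" "t / (a + 1) \<in> Y" "t * \<delta> a = t / (a + 1) * (d * a + 1)"
        "t = t / (a + 1) * (a + 1)"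
      using that a pos A' by (auto simp: S_def G_def \<delta>_def)
  qed
  have t_pos: "0 < t" if "a \<in> S t" for a t
    using Y(2)[OF S_D(4)[OF that]] S_D(3)[OF that] by (simp add: zero_less_divide_iff)

  \<comment> \<open>For fixed \<open>y\<close> the intervals belong to consecutive pairs
    \<open>(a, d * a)\<close> of \<open>A\<close>, so together they meet \<open>Z\<close> in at most
    \<open>z\<close> points.\<close>
  have bad: "2 * z / n * real (card {u \<in> Y \<times> A'. 2 * z / n < real (w u)}) \<le> m * z"
  proof (rule markov_count)
    have "(\<Sum>a\<in>A'. w (y, a)) \<le> card Z" if "y \<in> Y" for y
    proof -
      have "(\<Sum>a\<in>A'. w (y, a)) = (\<Sum>p\<in>(\<lambda>a. (a, d * a)) ` A'. gap Z (y * (fst p + 1), y * (snd p + 1)))"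
        by (subst sum.reindex) (auto simp: inj_on_def w_def)
      also have "\<dots> \<le> (\<Sum>p\<in>consec A. gap Z (y * (fst p + 1), y * (snd p + 1)))"
        by (rule sum_mono2) (use A in \<open>auto simp: A'_def\<close>)
      also have "\<dots> \<le> card Z"
        using sum_gap_consec[of A Z "\<lambda>a. y * (a + 1)" Z] A finZ Y(2)[OF that]
        by (simp add: case_prod_unfold)
      finally show ?thesis .
    qed
    then have "(\<Sum>y\<in>Y. \<Sum>a\<in>A'. w (y, a)) \<le> (\<Sum>y\<in>Y. card Z)" by (rule sum_mono)
    then have "(\<Sum>u\<in>Y \<times> A'. w u) \<le> card Y * card Z"
      by (simp add: sum.cartesian_product)
    then show "(\<Sum>u\<in>Y \<times> A'. real (w u)) \<le> m * z"
      by (simp add: m_def z_def flip: of_nat_mult of_nat_sum)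
  qed (use Y A' in auto)
  have G_large: "n * m / 2 \<le> real (card G)"
  proof (cases "z = 0")
    case True
    then have "Z = {}" using finZ by (simp add: z_def)
    moreover obtain a where "a \<in> A'" using n by (auto simp: n_def card_gt_0_iff)
    ultimately have "Y = {}" using ZI A'(2) by blast
    then show ?thesis by (simp add: m_def)
  next
    case False
    let ?B = "{u \<in> Y \<times> A'. 2 * z / n < real (w u)}"
    have small: "real (card ?B) \<le> n * m / 2"
      using bad n False z0 by (simp add: field_simps)
    have split: "Y \<times> A' = G \<union> ?B" by (auto simp: G_def)
    have "card (G \<union> ?B) = card G + card ?B"
      by (rule card_Un_disjoint) (use Y A' in \<open>auto simp: G_def\<close>)
    then have "card (Y \<times> A') = card G + card ?B" by (simp only: split[symmetric])
    then have "n * m = real (card G) + real (card ?B)"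
      by (simp add: card_cartesian_product n_def m_def mult.commute flip: of_nat_mult of_nat_add)
    then show ?thesis using small by simp
  qed
  have card_G: "card G = (\<Sum>t\<in>Z. card (S t))"
  proof -
    let ?p = "\<lambda>(y, a). y * (a + 1)"
    have nz: "a + 1 \<noteq> 0" if "a \<in> A'" for a using pos(1)[OF that] by simp
    have "?p ` G \<subseteq> Z" using ZI A' by (auto simp: G_def)
    then have "card G = (\<Sum>t\<in>Z. card {u \<in> G. ?p u = t})"
      using sum.group[of G Z ?p "\<lambda>_. 1 :: nat"] finG finZ by simp
    also have "\<dots> = (\<Sum>t\<in>Z. card (S t))"
    proof (rule sum.cong)
      fix t
      have "bij_betw snd {u \<in> G. ?p u = t} (S t)"
      proof (rule bij_betw_byWitness[where f' = "\<lambda>a. (t / (a + 1), a)"])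
        show "\<forall>u\<in>{u \<in> G. ?p u = t}. (t / (snd u + 1), snd u) = u"
          using nz by (auto simp: G_def)
        show "snd ` {u \<in> G. ?p u = t} \<subseteq> S t"
          using nz by (auto simp: G_def S_def)
        show "(\<lambda>a. (t / (a + 1), a)) ` S t \<subseteq> {u \<in> G. ?p u = t}"
          using nz by (auto simp: S_def)
      qed simp
      then show "card {u \<in> G. ?p u = t} = card (S t)" by (rule bij_betw_same_card)
    qed simp
    finally show ?thesis .
  qed

  define J where "J = Sigma Z (\<lambda>t. consec (S t))"
  \<comment> \<open>Passing to neighbours loses at most one element for each \<open>t\<close>, hence
    the loss \<open>z\<close>.\<close>
  have J_large: "real (card G) \<le> real (card J) + z"
  proof -
    have "card G \<le> (\<Sum>t\<in>Z. card (consec (S t)) + 1)"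
      unfolding card_G by (intro sum_mono card_le_card_consec finS)
    also have "\<dots> = card J + card Z"
      using finZ finS by (simp add: J_def card_SigmaI sum_Suc)
    finally show ?thesis by (simp add: z_def flip: of_nat_add)
  qed
  \<comment> \<open>The extra factor \<open>b\<close> places the pair \<open>(b * a, b * a')\<close>
    in \<open>prodset A A\<close>.\<close>
  define I where "I = J \<times> A"
  define f where "f = (\<lambda>((t, p), b :: real). (t * \<delta> (fst p), t * \<delta> (snd p)))"
  define h where "h = (\<lambda>((t :: real, p), b :: real). (b * fst p, b * snd p))"
  have finI: "finite I" using A finZ finS by (simp add: I_def J_def)
  have I_D: "t \<in> Z" "a \<in> S t" "a' \<in> S t" "a < a'" "b \<in> A" "0 < b"
    if "((t, (a, a')), b) \<in> I" for t a a' b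
    using that A by (auto simp: I_def J_def consec_def)

  \<comment> \<open>The first gaps cost at most \<open>2 * z / n\<close> for each of the
    \<open>z * N\<close> choices of \<open>t\<close> and \<open>b\<close>; the second cost at most
    \<open>M\<close> for each such choice.\<close>
  have "real (card I) ^ 3 \<le> 32 * 2 * real (card Z) * real (card (prodset A A))
      * (N * (z * (2 * z / n))) * (z * (N * M))"
  proof (rule two_gap_count[where f = f and h = h])
    show "f i \<in> Z \<times> Z \<and> fst (f i) < snd (f i)" if "i \<in> I" for i
    proof -
      obtain t a a' b where i: "i = ((t, (a, a')), b)" by (metis prod.collapse)
      note D = I_D[OF that[unfolded i]]
      have "t * \<delta> u \<in> Z" if "u \<in> S t" for u
        using S_D[OF that] ZI pos(2) by metis
      then show ?thesis
        using D t_pos[OF D(2)] \<delta>_mono S_D(3) by (simp add: i f_def)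
    qed
    show "h i \<in> prodset A A \<times> prodset A A \<and> fst (h i) < snd (h i)" if "i \<in> I" for i
    proof -
      obtain t a a' b where i: "i = ((t, (a, a')), b)" by (metis prod.collapse)
      show ?thesis
        using I_D[OF that[unfolded i]] S_D(2) by (auto simp: i h_def prodset_def)
    qed
    show "(\<Sum>i\<in>I. real (gap Z (f i))) \<le> N * (z * (2 * z / n))"
    proof -
      have "real (\<Sum>p\<in>consec (S t). gap Z (t * \<delta> (fst p), t * \<delta> (snd p))) \<le> 2 * z / n" for t
      proof (cases "S t = {}")
        case True
        then have "consec (S t) = {}" using consec_subset[of "S t"] by blast
        then show ?thesis using z0 n by simp
      next
        case False
        define a where "a = Max (S t)"
        have a: "a \<in> S t" unfolding a_def by (rule Max_in[OF finS False])
        have le: "u \<le> a" if "u \<in> S t" for u unfolding a_def using that finS by (rule Max_ge[rotated])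
        have t: "0 < t" by (rule t_pos[OF a])
        have mono: "t * \<delta> u \<le> t * \<delta> v" if "u \<in> S t" "u \<le> v" for u v
          using \<delta>_mono[of u v] S_D(3)[OF that(1)] that(2) t by (cases "u = v") auto
        \<comment> \<open>The whole chain lies in the window from \<open>t\<close> to the image of
          the largest element \<open>a\<close>, and this window is short because
          \<open>(t / (a + 1), a)\<close> belongs to \<open>G\<close>.\<close>
        have "(\<Sum>(u, v)\<in>consec (S t). gap Z (t * \<delta> u, t * \<delta> v)) \<le> card (Z \<inter> {t<..t * \<delta> a})"
        proof (rule sum_gap_consec)
          fix u v assume uv: "(u, v) \<in> consec (S t)"
          then have "u \<in> S t" "v \<in> S t" by (auto simp: consec_def)
          then have "t \<le> t * \<delta> u" "t * \<delta> v \<le> t * \<delta> a"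
            using t \<delta>_gt[of u] S_D(3)[of u t] mono le by auto
          then show "Z \<inter> {t * \<delta> u<..t * \<delta> v} \<subseteq> Z \<inter> {t<..t * \<delta> a}" by auto
        qed (use finS finZ mono in auto)
        also have "\<dots> = w (t / (a + 1), a)"
          using S_D(5,6)[OF a] by (simp add: w_def gap_def)
        also have "real \<dots> \<le> 2 * z / n"
          using a by (simp add: S_def G_def)
        finally show ?thesis by (simp add: case_prod_unfold)
      qed
      then have "(\<Sum>t\<in>Z. real (\<Sum>p\<in>consec (S t). gap Z (t * \<delta> (fst p), t * \<delta> (snd p)))) \<le> (\<Sum>t\<in>Z. 2 * z / n)"
        by (rule sum_mono)
      then have "(\<Sum>j\<in>J. real (gap Z (f (j, b)))) \<le> z * (2 * z / n)" for b
        using finZ finS by (simp add: J_def f_def z_def sum.Sigma case_prod_unfold)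
      then have "(\<Sum>b\<in>A. \<Sum>j\<in>J. real (gap Z (f (j, b)))) \<le> (\<Sum>b\<in>A. z * (2 * z / n))"
        by (intro sum_mono)
      also have "(\<Sum>b\<in>A. \<Sum>j\<in>J. real (gap Z (f (j, b)))) = (\<Sum>i\<in>I. real (gap Z (f i)))"
        by (subst sum.swap) (simp add: I_def sum.cartesian_product)
      finally show ?thesis by (simp add: N_def)
    qed
    show "(\<Sum>i\<in>I. real (gap (prodset A A) (h i))) \<le> z * (N * M)"
    proof -
      have "(\<Sum>p\<in>consec (S t). gap (prodset A A) (h ((t, p), b))) \<le> card (prodset A A)"
        if "b \<in> A" for t b
        using sum_gap_scaled[of A "S t" b] A finS S_D(2) that by (auto simp: h_def)
      then have "(\<Sum>t\<in>Z. \<Sum>b\<in>A. \<Sum>p\<in>consec (S t). gap (prodset A A) (h ((t, p), b)))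
          \<le> (\<Sum>t\<in>Z. \<Sum>b\<in>A. card (prodset A A))"
        by (intro sum_mono)
      also have "(\<Sum>t\<in>Z. \<Sum>b\<in>A. \<Sum>p\<in>consec (S t). gap (prodset A A) (h ((t, p), b)))
          = (\<Sum>t\<in>Z. \<Sum>p\<in>consec (S t). \<Sum>b\<in>A. gap (prodset A A) (h ((t, p), b)))"
        by (intro sum.cong refl sum.swap)
      also have "\<dots> = (\<Sum>j\<in>J. \<Sum>b\<in>A. gap (prodset A A) (h (j, b)))"
        using finZ finS by (simp add: J_def sum.Sigma case_prod_unfold)
      also have "\<dots> = (\<Sum>i\<in>I. gap (prodset A A) (h i))"
        by (simp add: I_def sum.cartesian_product case_prod_unfold)
      finally show ?thesis
        by (simp add: N_def z_def M_def flip: of_nat_mult of_nat_sum)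
    qed
    show "real (card {j \<in> I. f j = f i \<and> h j = h i}) \<le> 2" if "i \<in> I" for i
    proof -
      obtain t a a' b where i: "i = ((t, (a, a')), b)" by (metis prod.collapse)
      note D = I_D[OF \<open>i \<in> I\<close>[unfolded i]]
      have a: "0 < a" "0 < a'" using S_D(3) D by auto
      define e x where "e = a' / a" and "x = \<delta> a' / \<delta> a"
      have e: "a' = e * a" "0 < e" using a by (auto simp: e_def)
      have \<delta>_pos: "0 < \<delta> u" if "0 < u" for u using \<delta>_gt[OF that] by linarith
      have x: "1 < x" using \<delta>_mono[OF a(1) D(4)] \<delta>_pos[OF a(1)] by (simp add: x_def)
      \<comment> \<open>Coefficients of \<open>\<delta> (e * u) = x * \<delta> u\<close> after
        clearing denominators; the leading one is nonzero since \<open>1 < x\<close>.\<close>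
      define \<alpha> \<beta> where "\<alpha> = d * e * (1 - x)" and "\<beta> = (1 + d * e) - x * (d + e)"
      have quad: "\<alpha> * u\<^sup>2 + \<beta> * u + (1 - x) = 0" if "0 < u" "\<delta> (e * u) = x * \<delta> u" for u
      proof -
        have "0 < e * u + 1" "0 < u + 1" using that e by (auto simp: add_pos_pos)
        then have "(d * (e * u) + 1) * (u + 1) = x * ((d * u + 1) * (e * u + 1))"
          using that(2) by (simp add: \<delta>_def field_simps)
        then show ?thesis by (simp add: \<alpha>_def \<beta>_def power2_eq_square algebra_simps)
      qed
      have root_a: "\<delta> (e * a) = x * \<delta> a" using \<delta>_pos[OF a(1)] by (simp add: x_def e(1)[symmetric])
      \<comment> \<open>Rebuilds the whole index from its smaller element \<open>u\<close>, given
        the two recorded pairs.\<close>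
      define g where "g = (\<lambda>u. ((t * \<delta> a / \<delta> u, (u, e * u)), b * a / u))"
      have "j \<in> g ` {a, - \<beta> / \<alpha> - a}" if j: "j \<in> I" "f j = f i" "h j = h i" for j
      proof -
        obtain t1 a1 a1' b1 where j_eq: "j = ((t1, (a1, a1')), b1)" by (metis prod.collapse)
        note D1 = I_D[OF j(1)[unfolded j_eq]]
        have a1: "0 < a1" "0 < a1'" using S_D(3) D1 by auto
        have eqs: "t1 * \<delta> a1 = t * \<delta> a" "t1 * \<delta> a1' = t * \<delta> a'" "b1 * a1 = b * a" "b1 * a1' = b * a'"
          using j(2,3) by (auto simp: f_def h_def i j_eq)
        have b1: "b1 = b * a / a1" using eqs(3) a1 by (simp add: eq_divide_eq)
        have t1: "t1 = t * \<delta> a / \<delta> a1" using eqs(1) \<delta>_pos[OF a1(1)] by (simp add: eq_divide_eq)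
        have "b * (a * a1') = b * (a' * a1)" using eqs(3,4) by algebra
        then have "a * a1' = a * (e * a1)" using D(6) by (simp add: e(1))
        then have a1': "a1' = e * a1" using a by simp
        have "t * (\<delta> a * \<delta> a1') = t * (\<delta> a' * \<delta> a1)"
          using eqs(1,2) by algebra
        then have "\<delta> a * \<delta> a1' = \<delta> a' * \<delta> a1" using t_pos[OF D(2)] by simp
        then have "\<delta> (e * a1) = x * \<delta> a1"
          using \<delta>_pos[OF a(1)] by (simp add: x_def a1' field_simps)
        then have "a1 = a \<or> a1 = - \<beta> / \<alpha> - a"
          using quadratic_second_root[OF _ quad[OF a(1) root_a] quad[OF a1(1)]] x d e
          by (simp add: \<alpha>_def)
        moreover have "j = g a1" by (simp add: j_eq g_def a1' b1 t1)
        ultimately show ?thesis by auto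
      qed
      then have "{j \<in> I. f j = f i \<and> h j = h i} \<subseteq> g ` {a, - \<beta> / \<alpha> - a}" by blast
      then have "card {j \<in> I. f j = f i \<and> h j = h i} \<le> card (g ` {a, - \<beta> / \<alpha> - a})"
        by (rule card_mono[rotated]) simp
      also have "\<dots> \<le> card {a, - \<beta> / \<alpha> - a}" by (rule card_image_le) simp
      also have "\<dots> \<le> 2" by (simp add: card_insert_if)
      finally show ?thesis by simp
    qed
  qed (use A finI finZ in auto)
  then have "(real (card J) * N) ^ 3 \<le> 32 * 2 * z * M * (N * (z * (2 * z / n))) * (z * (N * M))"
    unfolding I_def card_cartesian_product of_nat_mult N_def[symmetric] z_def[symmetric] M_def[symmetric] .
  also have "\<dots> = 128 * M\<^sup>2 * N\<^sup>2 * z ^ 4 / n"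
    by (simp add: power2_eq_square power4_eq_xxxx)
  finally have key: "(real (card J) * N) ^ 3 \<le> 128 * M\<^sup>2 * N\<^sup>2 * z ^ 4 / n" .
  have M: "0 \<le> M" "M \<le> K * N" using K by (auto simp: M_def N_def)
  have K1: "0 < K" using \<open>1 \<le> K\<close> by simp
  have Nn4: "N ^ 4 \<le> 2 ^ 20 * K ^ 8 * n ^ 4"
  proof -
    have "N ^ 4 \<le> (32 * K\<^sup>2 * n) ^ 4" using Nn N by (intro power_mono) auto
    then show ?thesis by (simp add: power_mult_distrib flip: power_mult)
  qed
  have "(N * m) ^ 3 \<le> 2 ^ 33 * K ^ 10 * z ^ 4"
  \<comment> \<open>If \<open>z\<close> is small, \<open>J\<close> keeps at least
    \<open>n * m / 4\<close> elements and \<open>key\<close> applies. Otherwise \<open>z\<close>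
    exceeds \<open>n * m / 4\<close>, which already gives a fourth power of \<open>N * m\<close> up
    to powers of \<open>K\<close>.\<close>
  proof (cases "z \<le> n * m / 4")
    case True
    then have "n * m / 4 \<le> real (card J)" using G_large J_large by linarith
    then have "(n * m / 4 * N) ^ 3 \<le> (real (card J) * N) ^ 3"
      using n m0 N by (intro power_mono mult_right_mono) auto
    also have "\<dots> \<le> 128 * (K * N)\<^sup>2 * N\<^sup>2 * z ^ 4 / n"
      using key M n z0 by (elim order_trans) (intro divide_right_mono mult_right_mono mult_left_mono power_mono, auto)
    finally have "(n * m / 4 * N) ^ 3 * n \<le> 128 * (K * N)\<^sup>2 * N\<^sup>2 * z ^ 4"
      using n by (simp only: pos_le_divide_eq)
    moreover have "N ^ 3 * (n ^ 4 * m ^ 3) = 64 * ((n * m / 4 * N) ^ 3 * n)"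
      by (simp add: power3_eq_cube power4_eq_xxxx)
    moreover have "N ^ 3 * (8192 * K\<^sup>2 * N * z ^ 4) = 64 * (128 * (K * N)\<^sup>2 * N\<^sup>2 * z ^ 4)"
      by (simp add: power3_eq_cube power2_eq_square)
    ultimately have "N ^ 3 * (n ^ 4 * m ^ 3) \<le> N ^ 3 * (8192 * K\<^sup>2 * N * z ^ 4)"
      by linarith
    then have *: "n ^ 4 * m ^ 3 \<le> 8192 * K\<^sup>2 * N * z ^ 4"
      by (rule mult_left_le_imp_le) (use N in simp)
    have "N * (N * m) ^ 3 = N ^ 4 * m ^ 3" by (simp add: power3_eq_cube power4_eq_xxxx)
    also have "\<dots> \<le> 2 ^ 20 * K ^ 8 * n ^ 4 * m ^ 3" using Nn4 m0 by (intro mult_right_mono) auto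
    also have "\<dots> = 2 ^ 20 * K ^ 8 * (n ^ 4 * m ^ 3)" by simp
    also have "\<dots> \<le> 2 ^ 20 * K ^ 8 * (8192 * K\<^sup>2 * N * z ^ 4)"
      using * K1 by (intro mult_left_mono) auto
    also have "\<dots> = N * (2 ^ 33 * K ^ 10 * z ^ 4)"
    proof -
      have "K ^ 10 = K ^ 8 * K\<^sup>2" by (simp flip: power_add)
      then show ?thesis by simp
    qed
    finally show ?thesis by (rule mult_left_le_imp_le) (use N in simp)
  next
    case False
    show ?thesis
    proof (cases "m = 0")
      case False
      then have "1 \<le> m" by (simp add: m_def)
      then have "1 * 1 \<le> N * m" using N by (intro mult_mono) auto
      then have "(N * m) ^ 3 \<le> (N * m) ^ 4" by (intro power_increasing) auto
      also have "\<dots> \<le> (2 ^ 20 * K ^ 8 * n ^ 4) * m ^ 4"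
        unfolding power_mult_distrib using Nn4 by (intro mult_right_mono) auto
      also have "\<dots> = 2 ^ 28 * K ^ 8 * (n * m / 4) ^ 4"
        by (simp add: power_mult_distrib power_divide)
      also have "\<dots> \<le> 2 ^ 28 * K ^ 8 * z ^ 4"
        using \<open>\<not> z \<le> n * m / 4\<close> n m0 K1 by (intro mult_left_mono power_mono) auto
      also have "\<dots> \<le> 2 ^ 33 * K ^ 10 * z ^ 4"
        using \<open>1 \<le> K\<close> z0 by (intro mult_right_mono mult_mono power_increasing) auto
      finally show ?thesis .
    qed (use K1 in simp)
  qed
  then show ?thesis by (simp add: N_def m_def z_def Z_def)
qed

section \<open>Triple products\<close>

lemma triple_prod_eq: "triple_prod B = prodset B (prodset B B)"
  by (fastforce simp: triple_prod_def prodset_def mult.assoc)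

text \<open>Write \<open>N ^ 9\<close> as \<open>N ^ 3 * (N\<^sup>2) ^ 3\<close>, bound
  \<open>N\<^sup>2\<close> by the size \<open>m\<close> of the double product set, and apply the
  lower bound for \<open>(N * m) ^ 3\<close> with that set as \<open>Y\<close>.\<close>

lemma card_triple_prod_shift1:
  assumes A: "finite A" "A \<noteq> {}" "\<And>a. a \<in> A \<Longrightarrow> 0 < a" and "1 \<le> K"
    and K: "real (card (prodset A A)) \<le> K * real (card A)"
  shows "real (card A) ^ 9
    \<le> 2 ^ 33 * 1025 ^ 3 * K ^ 22 * (1 + ln (real (card A))) ^ 3 * real (card (triple_prod (shift1 A))) ^ 4"
proof -
  define N where "N = real (card A)"
  define L where "L = 1 + ln N"
  define Y where "Y = prodset (shift1 A) (shift1 A)"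
  define m where "m = real (card Y)"
  define z where "z = real (card (triple_prod (shift1 A)))"
  have fin: "finite (shift1 A)" using A by (simp add: shift1_def)
  have N: "1 \<le> N" using A by (simp add: N_def Suc_le_eq card_gt_0_iff)
  have L: "1 \<le> L" using N by (simp add: L_def)
  have K1: "1 \<le> K ^ k" for k :: nat using \<open>1 \<le> K\<close> by simp
  have z: "1 \<le> z"
  proof -
    have "triple_prod (shift1 A) \<noteq> {}" using A by (auto simp: triple_prod_def shift1_def)
    then show ?thesis
      using fin by (simp add: z_def triple_prod_eq Suc_le_eq card_gt_0_iff)
  qed
  define c :: real where "c = 2 ^ 33 * 1025 ^ 3"
  have c: "1 \<le> c" by (simp add: c_def)
  have "N ^ 9 \<le> c * K ^ 22 * L ^ 3 * z ^ 4"
  proof (cases "2 \<le> card A")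
    case True
    have m: "N\<^sup>2 \<le> 1025 * K ^ 4 * L * m"
      using card_prodset_shift1[OF A \<open>1 \<le> K\<close> K] by (simp add: N_def L_def m_def Y_def)
    have zm: "(N * m) ^ 3 \<le> 2 ^ 33 * K ^ 10 * z ^ 4"
      unfolding N_def m_def z_def triple_prod_eq Y_def[symmetric]
    proof (rule card_prodset_shift1_lower[OF A(1,3) True \<open>1 \<le> K\<close> K])
      show "finite Y" using fin by (simp add: Y_def)
      show "0 < y" if "y \<in> Y" for y
        using that A(3) by (auto simp: Y_def prodset_def shift1_def intro!: mult_pos_pos add_pos_pos)
    qed
    have "N ^ 9 = N ^ 3 * (N\<^sup>2) ^ 3" by (simp flip: power_mult power_add)
    also have "\<dots> \<le> N ^ 3 * (1025 * K ^ 4 * L * m) ^ 3"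
      using m N by (intro mult_left_mono power_mono) auto
    also have "\<dots> = 1025 ^ 3 * (K ^ 4) ^ 3 * L ^ 3 * (N * m) ^ 3"
      by (simp add: power_mult_distrib)
    also have "\<dots> \<le> 1025 ^ 3 * (K ^ 4) ^ 3 * L ^ 3 * (2 ^ 33 * K ^ 10 * z ^ 4)"
      using zm K1[of 4] L by (intro mult_left_mono) auto
    also have "\<dots> = c * ((K ^ 4) ^ 3 * K ^ 10) * L ^ 3 * z ^ 4"
      by (simp only: c_def mult_ac)
    also have "(K ^ 4) ^ 3 * K ^ 10 = K ^ 22" by (simp flip: power_mult power_add)
    finally show ?thesis .
  next
    \<comment> \<open>A single element has no neighbours; then \<open>N = 1\<close> and every factor
      on the right is at least 1.\<close>
    case False
    then have "N = 1" using N by (simp add: N_def)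
    moreover have "1 * 1 * 1 * 1 \<le> c * K ^ 22 * L ^ 3 * z ^ 4"
      using K1[of 22] L z c by (intro mult_mono) auto
    ultimately show ?thesis by simp
  qed
  then show ?thesis unfolding N_def L_def z_def c_def .
qed

section \<open>Absorbing the logarithm into a power\<close>

theorem theorem8:
  shows "\<exists>c C D :: real. c > 0 \<and> C > 0 \<and> D > 0 \<and>
    (\<forall>(A :: real set) (K :: real).
       finite A \<and> (\<forall>a\<in>A. a > 0) \<and> K \<ge> 1 \<and>
       real (card (prodset A A)) \<le> K * real (card A) \<longrightarrow>
       real (card (triple_prod (shift1 A))) \<ge> D * real (card A) powr (2 + c) / K powr C)"
proof -
  define E' :: real where "E' = 2 ^ 33 * 1025 ^ 3"
  define E where "E = 343 * E'"
  have E': "0 < E'" by (simp add: E'_def)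
  then have E: "0 < E" by (simp add: E_def)
  have "E powr - (1/4) * real (card A) powr (2 + 1/8) / K powr (11/2)
      \<le> real (card (triple_prod (shift1 A)))"
    if asm: "finite A \<and> (\<forall>a\<in>A. a > 0) \<and> K \<ge> 1 \<and> real (card (prodset A A)) \<le> K * real (card A)"
    for A :: "real set" and K :: real
  proof (cases "A = {}")
    case False
    define N where "N = real (card A)"
    define z where "z = real (card (triple_prod (shift1 A)))"
    have N: "1 \<le> N" using False asm by (simp add: N_def Suc_le_eq card_gt_0_iff)
    have K: "1 \<le> K" using asm by simp
    define L where "L = 1 + ln N"
    \<comment> \<open>The exponent 1/6 makes the cube of the logarithmic factor cost only
      \<open>N powr (1/2)\<close>. Of \<open>N ^ 9\<close> there remains
      \<open>N powr (17/2)\<close>, whose fourth root has exponent 2 + 1/8; likewise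
      \<open>K ^ 22\<close> gives 11/2.\<close>
    have "ln N \<le> N powr (1/6) / (1/6)" using N by (intro ln_powr_bound) auto
    moreover have "1 \<le> N powr (1/6)" using N by (simp add: ge_one_powr_ge_zero)
    ultimately have "L \<le> 7 * N powr (1/6)" by (simp add: L_def)
    then have "L ^ 3 \<le> (7 * N powr (1/6)) ^ 3" using N by (intro power_mono) (auto simp: L_def)
    also have "\<dots> = 343 * N powr (1/2)"
      using N by (simp add: power_mult_distrib powr_power)
    finally have L3: "L ^ 3 \<le> 343 * N powr (1/2)" .
    have "N ^ 9 \<le> E' * K ^ 22 * L ^ 3 * z ^ 4"
      unfolding N_def L_def z_def E'_def
      by (rule card_triple_prod_shift1) (use asm False in auto)
    also have "\<dots> \<le> E' * K ^ 22 * (343 * N powr (1/2)) * z ^ 4"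
      using L3 K E' by (intro mult_right_mono mult_left_mono) auto
    finally have main: "N ^ 9 \<le> E * K ^ 22 * N powr (1/2) * z ^ 4" by (simp add: E_def)
    have "(E powr - (1/4) * N powr (2 + 1/8) / K powr (11/2)) ^ 4 = N powr (17/2) / (E * K ^ 22)"
    proof -
      have "(E powr - (1/4)) ^ 4 = 1 / E" using E by (simp add: powr_power powr_neg_one del: powr_minus)
      moreover have "(N powr (2 + 1/8)) ^ 4 = N powr (17/2)" using N by (simp add: powr_power)
      moreover have "(K powr (11/2)) ^ 4 = K ^ 22" using K by (simp add: powr_power powr_numeral)
      ultimately show ?thesis by (simp add: power_mult_distrib power_divide)
    qed
    also have "\<dots> \<le> z ^ 4"
    proof -
      have "N ^ 9 = N powr (17/2) * N powr (1/2)"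
        using N by (simp add: powr_numeral flip: powr_add)
      then have "N powr (17/2) * N powr (1/2) \<le> (E * K ^ 22 * z ^ 4) * N powr (1/2)"
        using main by (simp add: mult_ac)
      then have "N powr (17/2) \<le> E * K ^ 22 * z ^ 4"
        by (rule mult_right_le_imp_le) (use N in simp)
      then show ?thesis using K E by (simp add: pos_divide_le_eq mult_ac)
    qed
    finally have "E powr - (1/4) * N powr (2 + 1/8) / K powr (11/2) \<le> z"
      by (rule power_le_imp_le_base[where n = 3, simplified]) (simp add: z_def)
    then show ?thesis by (simp only: N_def z_def)
  \<comment> \<open>For empty \<open>A\<close> the left side vanishes, since
    \<open>0 powr x = 0\<close>.\<close>
  qed simp
  then show ?thesis
    using E by (intro exI[of _ "1/8"] exI[of _ "11/2"] exI[of _ "E powr - (1/4)"]) simp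
qed

end
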